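(* Let $\Omega=\Omega_D$, where $D$ is an open subset of $\mathbb{C}$, and let $f\in\mathcal{SR}(\Omega)$. If $\Omega$ is a slice domain then either (1) for each $J\in\mathbb{S}_{\mathbb{DH}}$, the intersection $V(f)\cap\mathbb{C}_J$ is closed and discrete in $\Omega_J$; or (2) $f$ vanishes identically. If $\Omega$ is a product domain then, in addition to cases (1) and (2), there is one further possibility: (3) There exists $J\in\mathbb{S}_{\mathbb{DH}}$ such that $f_{|\Omega\cap\mathbb{C}_J^+}\equiv0$ and $V(f)\cap\mathbb{C}_J^-$ is closed and discrete in $\Omega_J$. If $({}^{\pi}\!f)'_s\not\equiv0$ then $J$ is unique; if instead $({}^{\pi}\!f)'_s\equiv0$, then the imaginary units in $\mathbb{S}_{\mathbb{DH}}$ having the same property are exactly the elements of $T_{J_1}$. For all other $K\in\mathbb{S}_{\mathbb{DH}}$, the intersection $V(f)\cap\mathbb{C}_K$ is closed and discrete in $\Omega_K$.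
   Context: $\mathbb{H}$ is the algebra of quaternions, with conjugation $q\mapsto q^c$; $\mathrm{Im}(\mathbb{H})$ is the space of purely imaginary quaternions; $p\perp q$ means $pq^c+qp^c=0$. The dual quaternions are $\mathbb{DH}=\mathbb{H}+\epsilon\mathbb{H}\cong\mathbb{R}^8$, with elements $h=h_1+\epsilon h_2$, componentwise addition and product $hh'=h_1h'_1+\epsilon(h_1h'_2+h_2h'_1)$; $\pi(h)=h_1$ is the primal part (a subscript $1$ denotes the primal part). Put $h^c=h_1^c+\epsilon h_2^c$, $t(h)=h+h^c$, $n(h)=hh^c$. For $A=\mathbb{H}$ or $\mathbb{DH}$ let $\mathbb{S}_A=\{J\in A: t(J)=0,\ n(J)=1\}$ (the imaginary units). Let $\mathbb{C}_J=\mathbb{R}+\mathbb{R}J$, $\mathbb{C}_J^{+}=\{\alpha+\beta J:\alpha\in\mathbb{R},\beta>0\}$, $\mathbb{C}_J^{-}=\{\alpha+\beta J:\alpha\in\mathbb{R},\beta<0\}$, and $Q_{\mathbb{DH}}=\bigcup_{J\in\mathbb{S}_{\mathbb{DH}}}\mathbb{C}_J$. For $J\in\mathbb{S}_{\mathbb{DH}}$, $T_{J_1}=\{J_1+\epsilon\gamma:\gamma\in\mathrm{Im}(\mathbb{H}),\ \gamma\perp J_1\}$. For $D\subseteq\mathbb{C}$ invariant under complex conjugation, $\Omega_D=\{\alpha+\beta J:\alpha,\beta\in\mathbb{R},\ \alpha+i\beta\in D,\ J\in\mathbb{S}_{\mathbb{DH}}\}\subseteq Q_{\mathbb{DH}}$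 and $\Omega_J=\Omega\cap\mathbb{C}_J$ for $\Omega=\Omega_D$. $\Omega=\Omega_D$ is a slice domain if $D$ is open, connected, intersects $\mathbb{R}$ and is preserved by complex conjugation; it is a product domain if $D$ is open, does not intersect $\mathbb{R}$ and has two connected components swapped by complex conjugation. Let $\mathbb{DH}_{\mathbb{C}}=\mathbb{DH}\otimes_{\mathbb{R}}\mathbb{C}=\{a+\iota b: a,b\in\mathbb{DH}\}$, $\iota^2=-1$, $\iota$ central. A stem function is $F=F_1+\iota F_2:D\to\mathbb{DH}_{\mathbb{C}}$ with $F_1(\bar z)=F_1(z)$, $F_2(\bar z)=-F_2(z)$; it induces the slice function $f=\mathcal{I}(F):\Omega\to\mathbb{DH}$, $f(\alpha+\beta J)=F_1(\alpha+i\beta)+JF_2(\alpha+i\beta)$. For $D$ open, $f=\mathcal{I}(F)$ is slice regular if $F$ is of class $C^1$ and $\frac{\partial F}{\partial\alpha}+\iota\frac{\partial F}{\partial\beta}=0$; $\mathcal{SR}(\Omega)$ is the set of slice regular functions on $\Omega$. The primal part of $f$ is the quaternionic slice function ${}^{\pi}\!f:\Omega\cap\mathbb{H}\to\mathbb{H}$, ${}^{\pi}\!f(\alpha+\beta I)=\pi(F_1(\alpha+i\beta))+I\,\pi(F_2(\alpha+i\beta))$ for $I\in\mathbb{S}_{\mathbb{H}}$. Its spherical derivative is $({}^{\pi}\!f)'_s(w)=\frac12\mathrm{Im}(w)^{-1}({}^{\pi}\!f(w)-{}^{\pi}\!f(w^c))$ for $w\in(\Omega\cap\mathbb{H})\setminus\mathbb{R}$.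 $V(f)=\{x\in\Omega: f(x)=0\}$.
   Formalization: In (3), "all other K" is read as all K such that neither K nor −K has the stated property: since C_{−J}=C_J and f vanishes on the half-slice Ω∩C_J^+, the zero set on C_{−J} is never discrete, so the literal claim fails at K=−J. *)

theory Defs
  imports "HOL-Analysis.Analysis"
begin

section \<open>Quaternions\<close>

datatype quat = Quat (q0: real) (q1: real) (q2: real) (q3: real)

lemma quat_eq_iff: "p = q \<longleftrightarrow> q0 p = q0 q \<and> q1 p = q1 q \<and> q2 p = q2 q \<and> q3 p = q3 q"
  by (cases p; cases q) simp

text \<open>The involution is a class parameter so that trace, norm, imaginary units, slices and
  slice functions are defined once, for quaternions and dual quaternions alike.\<close>

class qconj =
  fixes qconj :: "'a \<Rightarrow> 'a"

instantiation quat :: ring_1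
begin

definition "0 = Quat 0 0 0 0"
definition "1 = Quat 1 0 0 0"
definition "p + q = Quat (q0 p + q0 q) (q1 p + q1 q) (q2 p + q2 q) (q3 p + q3 q)"
definition "p - q = Quat (q0 p - q0 q) (q1 p - q1 q) (q2 p - q2 q) (q3 p - q3 q)"
definition "- q = Quat (- q0 q) (- q1 q) (- q2 q) (- q3 q)"
definition "p * q = Quat
  (q0 p * q0 q - q1 p * q1 q - q2 p * q2 q - q3 p * q3 q)
  (q0 p * q1 q + q1 p * q0 q + q2 p * q3 q - q3 p * q2 q)
  (q0 p * q2 q - q1 p * q3 q + q2 p * q0 q + q3 p * q1 q)
  (q0 p * q3 q + q1 p * q2 q - q2 p * q1 q + q3 p * q0 q)"

instance
  by standard (simp_all add: zero_quat_def one_quat_def plus_quat_def minus_quat_def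
      uminus_quat_def times_quat_def algebra_simps)

end

instantiation quat :: real_algebra_1
begin

definition "scaleR r q = Quat (r * q0 q) (r * q1 q) (r * q2 q) (r * q3 q)"

instance
  by standard (simp_all add: scaleR_quat_def one_quat_def plus_quat_def times_quat_def algebra_simps)

end

instantiation quat :: real_inner
begin

definition inner_quat_def:
  "inner p q = q0 p * q0 q + q1 p * q1 q + q2 p * q2 q + q3 p * q3 q"
definition norm_quat_def: "norm (q::quat) = sqrt (inner q q)"
definition sgn_quat_def: "sgn (q::quat) = q /\<^sub>R norm q"
definition dist_quat_def: "dist (p::quat) q = norm (p - q)"
definition uniformity_quat_def:
  "(uniformity :: (quat \<times> quat) filter) = (INF e\<in>{0 <..}. principal {(x, y). dist x y < e})"
definition open_quat_def:
  "open (U :: quat set) \<longleftrightarrow> (\<forall>x\<in>U. eventually (\<lambda>(x', y). x' = x \<longrightarrow> y \<in> U) uniformity)"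

instance
proof
  fix p q r :: quat and a :: real
  show "inner p q = inner q p" and "inner (p + q) r = inner p r + inner q r"
    and "inner (a *\<^sub>R p) q = a * inner p q" and "0 \<le> inner p p"
    by (simp_all add: inner_quat_def plus_quat_def scaleR_quat_def algebra_simps)
  show "inner p p = 0 \<longleftrightarrow> p = 0"
    by (simp add: inner_quat_def zero_quat_def quat_eq_iff add_nonneg_eq_0_iff)
qed (rule norm_quat_def sgn_quat_def dist_quat_def open_quat_def uniformity_quat_def)+

end

instantiation quat :: qconj
begin
definition "qconj q = Quat (q0 q) (- q1 q) (- q2 q) (- q3 q)"
instance ..
end

instantiation quat :: division_ring
begin

definition inverse_quat_def: "inverse (q::quat) = qconj q /\<^sub>R (norm q)\<^sup>2"
definition divide_quat_def: "divide (p::quat) q = p * inverse q"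

instance
proof
  fix p q :: quat
  assume "p \<noteq> 0"
  then have "inner p p \<noteq> 0" by simp
  moreover have "qconj p * p = inner p p *\<^sub>R 1" "p * qconj p = inner p p *\<^sub>R 1"
    by (simp_all add: inner_quat_def qconj_quat_def times_quat_def one_quat_def scaleR_quat_def)
  ultimately show "inverse p * p = 1" "p * inverse p = 1"
    by (simp_all add: inverse_quat_def norm_quat_def)
qed (simp_all add: divide_quat_def inverse_quat_def qconj_quat_def zero_quat_def scaleR_quat_def)

end

definition quat_Im :: "quat \<Rightarrow> quat" where
  "quat_Im q = (1/2) *\<^sub>R (q - qconj q)"

definition imag_quats :: "quat set" where
  "imag_quats = {q. q0 q = 0}"

definition quat_perp :: "quat \<Rightarrow> quat \<Rightarrow> bool" where
  "quat_perp p q \<longleftrightarrow> p * qconj q + q * qconj p = 0"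


section \<open>Dual quaternions\<close>

text \<open>\<open>DQuat h1 h2\<close> is $h_1 + \epsilon h_2$.\<close>

datatype dquat = DQuat (primal: quat) (dual: quat)

lemma dquat_eq_iff: "h = k \<longleftrightarrow> primal h = primal k \<and> dual h = dual k"
  by (cases h; cases k) simp

instantiation dquat :: ring_1
begin

definition "0 = DQuat 0 0"
definition "1 = DQuat 1 0"
definition "h + k = DQuat (primal h + primal k) (dual h + dual k)"
definition "h - k = DQuat (primal h - primal k) (dual h - dual k)"
definition "- h = DQuat (- primal h) (- dual h)"
definition "h * k = DQuat (primal h * primal k) (primal h * dual k + dual h * primal k)"

instance
  by standard (simp_all add: zero_dquat_def one_dquat_def plus_dquat_def minus_dquat_def
      uminus_dquat_def times_dquat_def algebra_simps)

end

instantiation dquat :: real_algebra_1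
begin

definition "scaleR r h = DQuat (r *\<^sub>R primal h) (r *\<^sub>R dual h)"

instance
  by standard (simp_all add: scaleR_dquat_def one_dquat_def plus_dquat_def times_dquat_def
      algebra_simps)

end

text \<open>The Euclidean norm and topology of $\mathbb{R}^8$; this norm is unrelated to the
  algebra-valued $n(h) = h h^c$.\<close>

instantiation dquat :: real_inner
begin

definition inner_dquat_def:
  "inner h k = inner (primal h) (primal k) + inner (dual h) (dual k)"
definition norm_dquat_def: "norm (h::dquat) = sqrt (inner h h)"
definition sgn_dquat_def: "sgn (h::dquat) = h /\<^sub>R norm h"
definition dist_dquat_def: "dist (h::dquat) k = norm (h - k)"
definition uniformity_dquat_def:
  "(uniformity :: (dquat \<times> dquat) filter) = (INF e\<in>{0 <..}. principal {(x, y). dist x y < e})"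
definition open_dquat_def:
  "open (U :: dquat set) \<longleftrightarrow> (\<forall>x\<in>U. eventually (\<lambda>(x', y). x' = x \<longrightarrow> y \<in> U) uniformity)"

instance
proof
  fix p q r :: dquat and a :: real
  show "inner p q = inner q p" and "inner (p + q) r = inner p r + inner q r"
    and "inner (a *\<^sub>R p) q = a * inner p q" and "0 \<le> inner p p"
    by (simp_all add: inner_dquat_def plus_dquat_def scaleR_dquat_def inner_commute algebra_simps)
  show "inner p p = 0 \<longleftrightarrow> p = 0"
    by (simp add: inner_dquat_def zero_dquat_def dquat_eq_iff add_nonneg_eq_0_iff)
qed (rule norm_dquat_def sgn_dquat_def dist_dquat_def open_dquat_def uniformity_dquat_def)+

end

instantiation dquat :: qconj
begin
definition "qconj h = DQuat (qconj (primal h)) (qconj (dual h))"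
instance ..
end


section \<open>Imaginary units and slices\<close>

definition tr :: "'a::{ring_1, qconj} \<Rightarrow> 'a" where
  "tr h = h + qconj h"

definition nm :: "'a::{ring_1, qconj} \<Rightarrow> 'a" where
  "nm h = h * qconj h"

definition imag_units :: "'a::{ring_1, qconj} set" where
  "imag_units = {J. tr J = 0 \<and> nm J = 1}"

definition slice :: "'a::real_algebra_1 \<Rightarrow> 'a set" where
  "slice J = {of_real \<alpha> + \<beta> *\<^sub>R J | \<alpha> \<beta>. True}"

definition slice_pos :: "'a::real_algebra_1 \<Rightarrow> 'a set" where
  "slice_pos J = {of_real \<alpha> + \<beta> *\<^sub>R J | \<alpha> \<beta>. \<beta> > 0}"

definition slice_neg :: "'a::real_algebra_1 \<Rightarrow> 'a set" where
  "slice_neg J = {of_real \<alpha> + \<beta> *\<^sub>R J | \<alpha> \<beta>. \<beta> < 0}"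

text \<open>$T_{J_1}$, as a function of the quaternion $J_1$.\<close>

definition T_set :: "quat \<Rightarrow> dquat set" where
  "T_set p = {DQuat p \<gamma> | \<gamma>. \<gamma> \<in> imag_quats \<and> quat_perp \<gamma> p}"

definition Omega :: "complex set \<Rightarrow> dquat set" where
  "Omega D = {of_real \<alpha> + \<beta> *\<^sub>R J | \<alpha> \<beta> J. Complex \<alpha> \<beta> \<in> D \<and> J \<in> imag_units}"

text \<open>$\Omega_D \cap \mathbb{H}$, with $\mathbb{H}$ embedded as $w \mapsto w + \epsilon 0$.\<close>

definition Omega_quat :: "complex set \<Rightarrow> quat set" where
  "Omega_quat D = {w. DQuat w 0 \<in> Omega D}"

definition slice_domain :: "complex set \<Rightarrow> bool" where
  "slice_domain D \<longleftrightarrow> open D \<and> connected D \<and> D \<inter> \<real> \<noteq> {} \<and> cnj ` D = D"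

definition product_domain :: "complex set \<Rightarrow> bool" where
  "product_domain D \<longleftrightarrow> open D \<and> D \<inter> \<real> = {} \<and>
     (\<exists>A B. components D = {A, B} \<and> A \<noteq> B \<and> cnj ` A = B \<and> cnj ` B = A)"


section \<open>Slice functions and slice regularity\<close>

text \<open>A pair \<open>(a, b)\<close> stands for the element $a + \iota b$ of the complexification of the
  algebra; \<open>iota_mult\<close> is multiplication by $\iota$.\<close>

definition iota_mult :: "'a \<times> 'a \<Rightarrow> 'a \<times> 'a::ab_group_add" where
  "iota_mult x = (- snd x, fst x)"

definition stem_function :: "complex set \<Rightarrow> (complex \<Rightarrow> 'a \<times> 'a::ab_group_add) \<Rightarrow> bool" where
  "stem_function D F \<longleftrightarrow>
     (\<forall>z\<in>D. fst (F (cnj z)) = fst (F z) \<and> snd (F (cnj z)) = - snd (F z))"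

text \<open>The slice function $\mathcal{I}(F)$. If \<open>F\<close> is a stem function on \<open>D\<close>, the values
  $F_1(\alpha + i\beta) + J F_2(\alpha + i\beta)$ agree for all representations
  $x = \alpha + \beta J$ of a point \<open>x\<close> of the domain; elsewhere the result is irrelevant.\<close>

definition slice_fun ::
    "(complex \<Rightarrow> 'a \<times> 'a) \<Rightarrow> 'a \<Rightarrow> 'a::{real_algebra_1, qconj}" where
  "slice_fun F x = (THE y. \<forall>\<alpha> \<beta>. \<forall>J\<in>imag_units. x = of_real \<alpha> + \<beta> *\<^sub>R J \<longrightarrow>
     y = fst (F (Complex \<alpha> \<beta>)) + J * snd (F (Complex \<alpha> \<beta>)))"

text \<open>\<open>F' z\<close> is the Fr\'echet derivative; \<open>F' z 1\<close> and \<open>F' z \<i>\<close> are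
  $\partial F/\partial\alpha$ and $\partial F/\partial\beta$.\<close>

definition regular_stem ::
    "complex set \<Rightarrow> (complex \<Rightarrow> 'a \<times> 'a::real_normed_vector) \<Rightarrow> bool" where
  "regular_stem D F \<longleftrightarrow> (\<exists>F' :: complex \<Rightarrow> complex \<Rightarrow>\<^sub>L ('a \<times> 'a).
     (\<forall>z\<in>D. (F has_derivative blinfun_apply (F' z)) (at z)) \<and> continuous_on D F' \<and>
     (\<forall>z\<in>D. blinfun_apply (F' z) 1 + iota_mult (blinfun_apply (F' z) \<i>) = 0))"

definition slice_regular :: "complex set \<Rightarrow> (dquat \<Rightarrow> dquat) set" where
  "slice_regular D = {f. \<exists>F. stem_function D F \<and> regular_stem D F \<and>
     (\<forall>x\<in>Omega D. f x = slice_fun F x)}"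

text \<open>The stem function inducing \<open>f\<close> is uniquely determined on \<open>D\<close>, so the choice only
  affects its values off \<open>D\<close>.\<close>

definition stem_of :: "complex set \<Rightarrow> (dquat \<Rightarrow> dquat) \<Rightarrow> complex \<Rightarrow> dquat \<times> dquat" where
  "stem_of D f = (SOME F. stem_function D F \<and> (\<forall>x\<in>Omega D. f x = slice_fun F x))"

definition primal_part :: "complex set \<Rightarrow> (dquat \<Rightarrow> dquat) \<Rightarrow> quat \<Rightarrow> quat" where
  "primal_part D f = slice_fun (\<lambda>z. (primal (fst (stem_of D f z)), primal (snd (stem_of D f z))))"

definition spherical_deriv :: "(quat \<Rightarrow> quat) \<Rightarrow> quat \<Rightarrow> quat" where
  "spherical_deriv g w = (1/2) *\<^sub>R (inverse (quat_Im w) * (g w - g (qconj w)))"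

definition zero_set :: "complex set \<Rightarrow> (dquat \<Rightarrow> dquat) \<Rightarrow> dquat set" where
  "zero_set D f = {x \<in> Omega D. f x = 0}"

definition closed_discrete_in :: "'a::topological_space set \<Rightarrow> 'a set \<Rightarrow> bool" where
  "closed_discrete_in U Z \<longleftrightarrow> closedin (top_of_set U) Z \<and> discrete Z"

text \<open>The units \<open>J\<close> such that \<open>f\<close> vanishes on the positive half of the slice of \<open>J\<close> but has
  closed and discrete zero set on the negative half.\<close>

definition half_zero_units :: "complex set \<Rightarrow> (dquat \<Rightarrow> dquat) \<Rightarrow> dquat set" where
  "half_zero_units D f = {J \<in> imag_units.
     (\<forall>x\<in>Omega D \<inter> slice_pos J. f x = 0) \<and>
     closed_discrete_in (Omega D \<inter> slice J) (zero_set D f \<inter> slice_neg J)}"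

end

theory Submission
  imports Defs "HOL-Complex_Analysis.Conformal_Mappings"
begin

text \<open>For an imaginary unit \<open>J\<close>, the restriction of \<open>f\<close> to the slice of \<open>J\<close> is
  $g_J = F_1 + J F_2$, which is holomorphic for the complex structure given by left
  multiplication by \<open>J\<close>. By the identity theorem \<open>g\<^sub>J\<close> either vanishes on a connected
  component of \<open>D\<close> or has no zeros accumulating in it. Since $g_J(\bar z) = g_{-J}(z)$, vanishing
  on a component and on its mirror image forces $F_1 = F_2 = 0$ there. If $f \not\equiv 0$ on a
  product domain, then \<open>J\<close> and \<open>K\<close> both give functions vanishing on the upper component iff one of
  them does and $(J - K) F_2 = 0$ there; the primal and dual parts of this equation decide between
  $J = K$ and $J_1 = K_1$.\<close>

section \<open>Imaginary units\<close>

lemma imag_units_square: "J \<in> imag_units \<Longrightarrow> J * J = - 1"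
  unfolding imag_units_def tr_def nm_def
  by (metis (mono_tags, lifting) add_eq_0_iff mem_Collect_eq minus_mult_right minus_minus)

lemma imag_units_mult_cancel: "J \<in> imag_units \<Longrightarrow> J * x = 0 \<longleftrightarrow> x = 0"
  using imag_units_square[of J] by (metis mult.assoc mult_minus1 mult_zero_right neg_equal_0_iff_equal)

text \<open>Put c = a - a'. Squaring b'K = c + bJ shows that 2cbJ is real. A real J cannot square to
  -1, so cb = 0, and the remaining equation b^2 = c^2 + b'^2 forces c = 0. Only ring identities
  enter, so quaternions and dual quaternions are both covered.\<close>

lemma slice_representation_unique:
  fixes J K :: "'a::real_algebra_1"
  assumes JJ: "J * J = - 1" and KK: "K * K = - 1"
    and eq: "of_real a + b *\<^sub>R J = of_real a' + b' *\<^sub>R K"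
  shows "a' = a \<and> (b = 0 \<and> b' = 0 \<or> b \<noteq> 0 \<and> b' = b \<and> K = J \<or> b \<noteq> 0 \<and> b' = - b \<and> K = - J)"
proof -
  define c where "c = a - a'"
  have e: "b' *\<^sub>R K = of_real c + b *\<^sub>R J"
    using eq by (simp add: c_def algebra_simps)
  have "(b' *\<^sub>R K) * (b' *\<^sub>R K) = of_real (- (b' * b'))"
    by (simp add: KK of_real_def)
  moreover have "(of_real c + b *\<^sub>R J) * (of_real c + b *\<^sub>R J)
      = of_real (c * c - b * b) + (2 * c * b) *\<^sub>R J"
    by (simp add: of_real_def algebra_simps JJ scaleR_2 flip: scaleR_add_left)
  ultimately have sq: "(2 * c * b) *\<^sub>R J = of_real (b * b - c * c - b' * b')"
    unfolding e by (simp add: algebra_simps)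
  have "c * b = 0"
  proof (rule ccontr)
    assume n: "c * b \<noteq> 0"
    define r where "r = (b * b - c * c - b' * b') / (2 * c * b)"
    have "J = (1 / (2 * c * b)) *\<^sub>R ((2 * c * b) *\<^sub>R J)"
      using n by simp
    also have "\<dots> = of_real r"
      unfolding sq r_def of_real_def by simp
    finally have "of_real (r * r) = (of_real (- 1) :: 'a)"
      using JJ by simp
    then have "r * r = - 1"
      by (simp only: of_real_eq_iff)
    then show False
      using zero_le_square[of r] by linarith
  qed
  with sq have "of_real (b * b - c * c - b' * b') = (0 :: 'a)"
    by (metis mult.assoc mult_zero_right scaleR_zero_left)
  then have s: "b * b = c * c + b' * b'"
    by (simp only: of_real_eq_0_iff)
  have c0: "c = 0"
    using \<open>c * b = 0\<close> s by (metis add_nonneg_eq_0_iff mult_eq_0_iff zero_le_square)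
  then have "b' = b \<or> b' = - b"
    using s by (auto simp: square_eq_iff)
  then show ?thesis
  proof
    assume "b' = b"
    then show ?thesis using e c0 by (auto simp: c_def)
  next
    assume b: "b' = - b"
    then have "b *\<^sub>R (K + J) = 0" using e c0 by (simp add: scaleR_add_right neg_eq_iff_add_eq_0)
    then show ?thesis using b c0 by (auto simp: c_def eq_neg_iff_add_eq_0)
  qed
qed

text \<open>The epsilon-part of J J^c is J_1 J_2^c + J_2 J_1^c, whose vanishing is perpendicularity;
  t(J) = 0 makes both parts imaginary.\<close>

lemma imag_units_dquat_iff:
  "J \<in> imag_units \<longleftrightarrow> primal J \<in> imag_units \<and> dual J \<in> imag_quats \<and> quat_perp (dual J) (primal J)"
  by (auto simp: imag_units_def tr_def nm_def imag_quats_def quat_perp_def dquat_eq_iff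
      quat_eq_iff zero_dquat_def one_dquat_def plus_dquat_def times_dquat_def qconj_dquat_def
      zero_quat_def one_quat_def plus_quat_def times_quat_def qconj_quat_def algebra_simps)

lemma T_set_primal:
  "J \<in> imag_units \<Longrightarrow> T_set (primal J) = {K \<in> imag_units. primal K = primal J}"
  by (auto simp: T_set_def imag_units_dquat_iff dquat_eq_iff intro!: exI[of _ "dual _"])

lemma uminus_imag_units: "J \<in> imag_units \<Longrightarrow> - J \<in> (imag_units :: dquat set)"
  by (auto simp: imag_units_def tr_def nm_def dquat_eq_iff
      quat_eq_iff zero_dquat_def one_dquat_def plus_dquat_def times_dquat_def qconj_dquat_def
      zero_quat_def one_quat_def plus_quat_def times_quat_def qconj_quat_def uminus_dquat_def
      uminus_quat_def algebra_simps)

lemma quat_i_imag_unit: "Quat 0 1 0 0 \<in> imag_units"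
  by (simp add: imag_units_def tr_def nm_def quat_eq_iff zero_quat_def one_quat_def plus_quat_def
      times_quat_def qconj_quat_def)

lemma DQuat_imag_unit: "DQuat I 0 \<in> imag_units \<longleftrightarrow> I \<in> imag_units"
  by (auto simp: imag_units_dquat_iff imag_quats_def quat_perp_def zero_quat_def times_quat_def
      plus_quat_def qconj_quat_def)

lemma of_real_dquat: "of_real a = DQuat (of_real a) 0"
  by (simp add: of_real_def scaleR_dquat_def one_dquat_def)


section \<open>Slice functions on a slice\<close>

definition slice_point :: "'a::real_algebra_1 \<Rightarrow> complex \<Rightarrow> 'a" where
  "slice_point J z = of_real (Re z) + Im z *\<^sub>R J"

text \<open>The g_J of the overview, placed on the complex plane so that different units can be
  compared at the same point.\<close>

definition stem_eval :: "(complex \<Rightarrow> 'a \<times> 'a) \<Rightarrow> 'a \<Rightarrow> complex \<Rightarrow> 'a::ring_1" where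
  "stem_eval F J z = fst (F z) + J * snd (F z)"

text \<open>The definite description is legitimate: besides z and J, a point is represented by the
  conjugate of z with -J, where the two signs cancel, and for real z by arbitrary units, where F_2
  vanishes.\<close>

lemma slice_fun_slice_point:
  fixes F :: "complex \<Rightarrow> 'a \<times> 'a::{real_algebra_1, qconj}"
  assumes D: "cnj ` D = D" and F: "stem_function D F" and z: "z \<in> D" and J: "J \<in> imag_units"
  shows "slice_fun F (slice_point J z) = stem_eval F J z"
  unfolding slice_fun_def
proof (rule the_equality)
  show "\<forall>\<alpha> \<beta>. \<forall>K\<in>imag_units. slice_point J z = of_real \<alpha> + \<beta> *\<^sub>R K \<longrightarrow>
     stem_eval F J z = fst (F (Complex \<alpha> \<beta>)) + K * snd (F (Complex \<alpha> \<beta>))"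
  proof (intro allI ballI impI)
    fix \<alpha> \<beta> and K :: 'a
    assume K: "K \<in> imag_units" and eq: "slice_point J z = of_real \<alpha> + \<beta> *\<^sub>R K"
    have cases: "\<alpha> = Re z \<and> (Im z = 0 \<and> \<beta> = 0 \<or> \<beta> = Im z \<and> K = J \<or> \<beta> = - Im z \<and> K = - J)"
      using slice_representation_unique[OF imag_units_square[OF J] imag_units_square[OF K]]
        eq[unfolded slice_point_def] by blast
    have cz: "fst (F (cnj z)) = fst (F z)" "snd (F (cnj z)) = - snd (F z)"
      using F z by (auto simp: stem_function_def)
    have real: "snd (F z) = 0" if "Im z = 0"
    proof -
      have "cnj z = z" using that by (simp add: complex_eq_iff)
      then have "snd (F z) + snd (F z) = 0" using cz(2) by (metis add.left_inverse)
      then show ?thesis by (metis scaleR_2 scaleR_eq_0_iff zero_neq_numeral)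
    qed
    from cases consider "Complex \<alpha> \<beta> = z" "Im z = 0" | "Complex \<alpha> \<beta> = z" "K = J"
      | "Complex \<alpha> \<beta> = cnj z" "K = - J"
      by (auto simp: complex_eq_iff)
    then show "stem_eval F J z = fst (F (Complex \<alpha> \<beta>)) + K * snd (F (Complex \<alpha> \<beta>))"
      by cases (auto simp: stem_eval_def real cz)
  qed
next
  fix y
  assume "\<forall>\<alpha> \<beta>. \<forall>K\<in>imag_units. slice_point J z = of_real \<alpha> + \<beta> *\<^sub>R K \<longrightarrow>
     y = fst (F (Complex \<alpha> \<beta>)) + K * snd (F (Complex \<alpha> \<beta>))"
  from this[rule_format, OF J, of "Re z" "Im z"]
  show "y = stem_eval F J z"
    by (simp add: slice_point_def stem_eval_def)
qed

text \<open>Membership witnessed by another unit can at most replace z by its conjugate, and D is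
  symmetric.\<close>

lemma slice_point_in_Omega_iff:
  assumes D: "cnj ` D = D" and J: "J \<in> imag_units"
  shows "slice_point J z \<in> Omega D \<longleftrightarrow> z \<in> D"
proof
  assume "slice_point J z \<in> Omega D"
  then obtain \<alpha> \<beta> K where *: "slice_point J z = of_real \<alpha> + \<beta> *\<^sub>R K"
    "Complex \<alpha> \<beta> \<in> D" "K \<in> imag_units"
    by (auto simp: Omega_def)
  have "\<alpha> = Re z \<and> (\<beta> = Im z \<or> \<beta> = - Im z)"
    using slice_representation_unique[OF imag_units_square[OF J] imag_units_square[OF *(3)]]
      *(1)[unfolded slice_point_def] by fastforce
  then have "z = Complex \<alpha> \<beta> \<or> z = cnj (Complex \<alpha> \<beta>)"
    by (auto simp: complex_eq_iff)
  then show "z \<in> D" using * D by blast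
next
  assume "z \<in> D"
  then have "slice_point J z = of_real (Re z) + Im z *\<^sub>R J \<and> Complex (Re z) (Im z) \<in> D \<and> J \<in> imag_units"
    using J by (simp add: slice_point_def)
  then show "slice_point J z \<in> Omega D"
    unfolding Omega_def by blast
qed

lemma Omega_cases:
  assumes "x \<in> Omega D"
  obtains z J where "z \<in> D" "J \<in> imag_units" "x = slice_point J z"
proof -
  from assms obtain \<alpha> \<beta> J where "x = of_real \<alpha> + \<beta> *\<^sub>R J" "Complex \<alpha> \<beta> \<in> D" "J \<in> imag_units"
    by (auto simp: Omega_def)
  then show thesis
    using that[of "Complex \<alpha> \<beta>" J] by (simp add: slice_point_def)
qed

lemma slice_eq: "slice J = range (slice_point J)"
  unfolding slice_def slice_point_def by (auto simp: image_iff) (metis complex.sel)+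

lemma slice_pos_eq: "slice_pos J = slice_point J ` {z. 0 < Im z}"
  unfolding slice_pos_def slice_point_def by (auto simp: image_iff) (metis complex.sel)+

lemma slice_neg_eq: "slice_neg J = slice_point J ` {z. Im z < 0}"
  unfolding slice_neg_def slice_point_def by (auto simp: image_iff) (metis complex.sel)+

lemma stem_eval_cnj:
  assumes "stem_function D F" "z \<in> D"
  shows "stem_eval F J (cnj z) = stem_eval F (- J) z"
  using assms by (simp add: stem_function_def stem_eval_def)

text \<open>The two evaluations add up to 2 F_1; what remains is J F_2 = 0, and J is invertible even
  where the algebra has zero divisors.\<close>

lemma stem_eval_zero:
  fixes F :: "complex \<Rightarrow> 'a \<times> 'a::{real_algebra_1, qconj}"
  assumes "J \<in> imag_units" "stem_eval F J z = 0" "stem_eval F (- J) z = 0"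
  shows "fst (F z) = 0 \<and> snd (F z) = 0"
proof -
  have "fst (F z) + fst (F z) = stem_eval F J z + stem_eval F (- J) z"
    by (simp add: stem_eval_def)
  then have "fst (F z) = 0"
    using assms by (metis add.right_neutral scaleR_2 scaleR_eq_0_iff zero_neq_numeral)
  with assms show ?thesis
    by (simp add: stem_eval_def imag_units_mult_cancel)
qed

text \<open>The primal part alone has norm |z|, because J_1 is a unit; the dual part can only add to
  it.\<close>

lemma norm_slice_point_ge:
  assumes "J \<in> imag_units"
  shows "norm z \<le> norm (slice_point J z :: dquat)"
proof -
  have J: "q0 (primal J) = 0"
    "(q1 (primal J))\<^sup>2 + (q2 (primal J))\<^sup>2 + (q3 (primal J))\<^sup>2 = 1"
    using assms by (auto simp: imag_units_def tr_def nm_def dquat_eq_iff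
      quat_eq_iff zero_dquat_def one_dquat_def plus_dquat_def times_dquat_def qconj_dquat_def
      zero_quat_def one_quat_def plus_quat_def times_quat_def qconj_quat_def power2_eq_square)
  have "inner (primal (slice_point J z)) (primal (slice_point J z)) = (Re z)\<^sup>2 + (Im z)\<^sup>2 *
      ((q1 (primal J))\<^sup>2 + (q2 (primal J))\<^sup>2 + (q3 (primal J))\<^sup>2)"
    by (simp add: slice_point_def of_real_def inner_quat_def plus_dquat_def scaleR_dquat_def
        one_dquat_def plus_quat_def scaleR_quat_def one_quat_def J(1) power2_eq_square algebra_simps)
  then have "(Re z)\<^sup>2 + (Im z)\<^sup>2 \<le> inner (slice_point J z) (slice_point J z)"
    by (simp add: inner_dquat_def J(2))
  then show ?thesis
    by (simp add: norm_dquat_def cmod_def)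
qed

text \<open>Since \<open>slice_point J\<close> does not shrink distances, a limit point of the image
  on the slice pulls back to a limit point of Z in D. A subset without limit points in the ambient
  set is relatively closed and discrete.\<close>

lemma closed_discrete_in_slice:
  fixes J :: dquat
  assumes D: "cnj ` D = D" and J: "J \<in> imag_units" and Z: "Z \<subseteq> D"
    and lim: "\<And>z. z \<in> D \<Longrightarrow> \<not> z islimpt Z"
  shows "closed_discrete_in (Omega D \<inter> slice J) (slice_point J ` Z)"
proof -
  have U: "Omega D \<inter> slice J = slice_point J ` D"
    using slice_point_in_Omega_iff[OF D J] by (auto simp: slice_eq)
  have dist: "dist y z \<le> dist (slice_point J y) (slice_point J z)" for y z
  proof -
    have "slice_point J y - slice_point J z = slice_point J (y - z)"
      by (simp add: slice_point_def algebra_simps)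
    then show ?thesis using norm_slice_point_ge[OF J] by (simp add: dist_norm)
  qed
  have "\<not> x islimpt slice_point J ` Z" if xU: "x \<in> slice_point J ` D" for x
  proof
    assume x: "x islimpt slice_point J ` Z"
    obtain z where z: "z \<in> D" "x = slice_point J z" using xU by blast
    have "z islimpt Z"
      unfolding islimpt_approachable
    proof (intro allI impI)
      fix e :: real assume "e > 0"
      then obtain y where "y \<in> Z" "slice_point J y \<noteq> slice_point J z"
        "dist (slice_point J y) (slice_point J z) < e"
        using x z unfolding islimpt_approachable by blast
      then show "\<exists>y\<in>Z. y \<noteq> z \<and> dist y z < e"
        using dist[of y z] by (intro bexI[of _ y]) auto
    qed
    then show False using lim z by blast
  qed
  moreover have "slice_point J ` Z \<subseteq> slice_point J ` D"
    using Z by blast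
  ultimately show ?thesis
    unfolding closed_discrete_in_def U closedin_limpt discrete_def isolated_in_islimpt_iff
    by (meson subsetD)
qed


section \<open>Holomorphy and the identity theorem\<close>

text \<open>Pairing with a fixed v turns F into a scalar function, for which the regularity equation
  becomes the Cauchy-Riemann equations.\<close>

lemma regular_stem_inner_holomorphic:
  fixes F :: "complex \<Rightarrow> 'a \<times> 'a::real_inner"
  assumes "regular_stem D F"
  shows "(\<lambda>z. Complex (inner v (fst (F z))) (inner v (snd (F z)))) holomorphic_on D"
proof -
  obtain F' :: "complex \<Rightarrow> complex \<Rightarrow>\<^sub>L ('a \<times> 'a)" where
    der: "\<And>z. z \<in> D \<Longrightarrow> (F has_derivative blinfun_apply (F' z)) (at z)" and
    CR: "\<And>z. z \<in> D \<Longrightarrow> blinfun_apply (F' z) 1 + iota_mult (blinfun_apply (F' z) \<i>) = 0"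
    using assms by (auto simp: regular_stem_def)
  have "((\<lambda>z. of_real (inner v (fst (F z))) + \<i> * of_real (inner v (snd (F z))))
      has_field_derivative Complex (inner v (fst (F' z 1))) (inner v (snd (F' z 1)))) (at z)"
    if z: "z \<in> D" for z
  proof -
    \<comment> \<open>Regularity multiplied by \<iota>: the derivative in direction
      \<open>\<i>\<close> is \<iota> times the one in direction 1.\<close>
    have fs: "fst (F' z \<i>) = - snd (F' z 1)" "snd (F' z \<i>) = fst (F' z 1)"
      using CR[OF z] by (auto simp: iota_mult_def prod_eq_iff add_eq_0_iff)
    have lin: "F' z h = Re h *\<^sub>R F' z 1 + Im h *\<^sub>R F' z \<i>" for h
    proof -
      have "h = Re h *\<^sub>R 1 + Im h *\<^sub>R \<i>" by (simp add: complex_eq_iff)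
      then show ?thesis by (metis blinfun.add_right blinfun.scaleR_right)
    qed
    have "((\<lambda>z. of_real (inner v (fst (F z))) + \<i> * of_real (inner v (snd (F z))))
      has_derivative (\<lambda>h. of_real (inner v (fst (F' z h))) + \<i> * of_real (inner v (snd (F' z h)))))
      (at z)"
      by (auto intro!: derivative_eq_intros der[OF z])
    moreover have "of_real (inner v (fst (F' z h))) + \<i> * of_real (inner v (snd (F' z h)))
        = Complex (inner v (fst (F' z 1))) (inner v (snd (F' z 1))) * h" for h
      by (simp add: lin[of h] fs complex_eq_iff inner_add_right algebra_simps)
    ultimately show ?thesis
      by (simp add: has_field_derivative_def)
  qed
  then have "(\<lambda>z. of_real (inner v (fst (F z))) + \<i> * of_real (inner v (snd (F z)))) holomorphic_on D"
    by (meson field_differentiable_at_within field_differentiable_def holomorphic_on_def)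
  then show ?thesis
    by (simp add: Complex_eq)
qed

text \<open>The adjoint of left multiplication by J for the inner product of R^8. It is not
  multiplication by J^c in general: the dual part of J pairs the primal part of one factor with the
  dual part of the other.\<close>

definition mult_adjoint :: "dquat \<Rightarrow> dquat \<Rightarrow> dquat" where
  "mult_adjoint J v = DQuat (qconj (primal J) * primal v + qconj (dual J) * dual v)
     (qconj (primal J) * dual v)"

lemma inner_mult_adjoint: "inner v (J * h) = inner (mult_adjoint J v) h"
  by (simp add: mult_adjoint_def inner_dquat_def inner_quat_def times_dquat_def times_quat_def
      plus_quat_def qconj_quat_def algebra_simps)

text \<open>Scalar holomorphic coordinates of g_J reduce the claim to the classical identity theorem
  on C.\<close>

lemma stem_eval_zeros_no_limpt:
  fixes F :: "complex \<Rightarrow> dquat \<times> dquat"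
  assumes F: "regular_stem D F" and J: "J \<in> imag_units"
    and C: "open C" "connected C" "C \<subseteq> D" and c: "c \<in> C" "stem_eval F J c \<noteq> 0" and z: "z \<in> C"
  shows "\<not> z islimpt {w \<in> D. stem_eval F J w = 0}"
proof
  assume "z islimpt {w \<in> D. stem_eval F J w = 0}"
  then have lim: "z islimpt {w \<in> C. stem_eval F J w = 0}"
    unfolding islimpt_def using C z by (metis (no_types, lifting) Int_iff mem_Collect_eq open_Int)
  define H where "H v w = Complex (inner v (fst (F w))) (inner v (snd (F w)))" for v w
  \<comment> \<open>After J is moved across the inner product, this holomorphic combination has real
    part <v, g_J> and imaginary part -<v, J g_J>, so it vanishes wherever g_J does.\<close>
  define \<phi> where "\<phi> v w = H v w - \<i> * H (mult_adjoint J v) w" for v w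
  have JJ: "J * (J * x) = - x" for x
    using imag_units_square[OF J] by (metis mult.assoc mult_minus1)
  have \<phi>: "\<phi> v w = Complex (inner v (stem_eval F J w)) (- inner v (J * stem_eval F J w))" for v w
    by (simp add: \<phi>_def H_def stem_eval_def complex_eq_iff distrib_left JJ inner_add_right
        inner_diff_right flip: inner_mult_adjoint)
  have "\<phi> v holomorphic_on C" for v
    unfolding \<phi>_def H_def using regular_stem_inner_holomorphic[OF F] C(3)
    by (intro holomorphic_intros) (meson holomorphic_on_subset)+
  then have "\<phi> v c = 0" for v
    by (rule analytic_continuation[OF _ C(1,2) _ z lim _ c(1)]) (auto simp: \<phi> complex_eq_iff)
  \<comment> \<open>With v = g_J(c) the real part is the squared norm of a nonzero value.\<close>
  from this[of "stem_eval F J c"] c(2) show False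
    by (simp add: \<phi> complex_eq_iff)
qed

text \<open>A connected set missing the real axis lies in one open half-plane, and conjugation puts
  the other component in the opposite one; A is whichever is the upper one.\<close>

lemma product_domain_upper_half:
  assumes "product_domain D"
  obtains A where "open A" "connected A" "A \<subseteq> {z. 0 < Im z}" "D = A \<union> cnj ` A"
proof -
  obtain A B where AB: "components D = {A, B}" "cnj ` A = B" "cnj ` B = A"
    and D: "open D" "D \<inter> \<real> = {}"
    using assms by (auto simp: product_domain_def)
  have U: "D = A \<union> B" using AB(1) Union_components[of D] by auto
  have op: "open A" "open B" using AB(1) D(1) open_components by blast+
  have conn: "connected A" "connected B" using AB(1) in_components_connected by blast+
  have "A \<subseteq> {z. 0 < Im z} \<union> {z. Im z < 0}"
    using D(2) U by (auto simp: complex_is_Real_iff disjoint_iff)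
  then have "{z. 0 < Im z} \<inter> A = {} \<or> {z. Im z < 0} \<inter> A = {}"
    using conn(1)
    by (intro connectedD) (auto simp: open_halfspace_Im_gt open_halfspace_Im_lt)
  then have "A \<subseteq> {z. Im z < 0} \<or> A \<subseteq> {z. 0 < Im z}"
    using \<open>A \<subseteq> _ \<union> _\<close> by blast
  then show thesis
  proof
    assume "A \<subseteq> {z. Im z < 0}"
    then have "B \<subseteq> {z. 0 < Im z}" using AB by auto
    then show thesis using that[of B] op conn U AB by auto
  next
    assume "A \<subseteq> {z. 0 < Im z}"
    then show thesis using that[of A] op conn U AB by auto
  qed
qed


section \<open>The spherical derivative of the primal part\<close>

text \<open>Two stem functions of the same f differ by one whose evaluations vanish at J and at -J,
  hence by zero on D. So the choice in \<open>stem_of\<close> may be replaced by the given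
  F.\<close>

lemma stem_of_eq:
  assumes D: "cnj ` D = D" and F: "stem_function D F" and f: "\<forall>x\<in>Omega D. f x = slice_fun F x"
  shows "stem_function D (stem_of D f)" and "z \<in> D \<Longrightarrow> stem_of D f z = F z"
proof -
  have S: "stem_function D (stem_of D f) \<and> (\<forall>x\<in>Omega D. f x = slice_fun (stem_of D f) x)"
    unfolding stem_of_def by (rule someI[of _ F]) (use F f in auto)
  then show "stem_function D (stem_of D f)" ..
  assume z: "z \<in> D"
  define J where "J = DQuat (Quat 0 1 0 0) 0"
  have J: "J \<in> imag_units" by (simp add: J_def DQuat_imag_unit quat_i_imag_unit)
  have eq: "stem_eval (stem_of D f) K z = stem_eval F K z" if "K \<in> imag_units" for K
    using S f slice_fun_slice_point[OF D _ z that] slice_point_in_Omega_iff[OF D that] z F by metis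
  define G where "G w = stem_of D f w - F w" for w
  have "stem_eval G K z = 0" if "K \<in> imag_units" for K
    using eq[OF that] by (simp add: stem_eval_def G_def algebra_simps)
  then have "fst (G z) = 0 \<and> snd (G z) = 0"
    using stem_eval_zero J uminus_imag_units by blast
  then show "stem_of D f z = F z"
    by (simp add: G_def prod_eq_iff)
qed

text \<open>The F_1 terms cancel in the difference, and the factor I in front of F_2 cancels against
  the inverse of Im(w), so the result does not depend on I.\<close>

lemma spherical_deriv_primal_part:
  assumes D: "cnj ` D = D" and F: "stem_function D F" and f: "\<forall>x\<in>Omega D. f x = slice_fun F x"
    and z: "z \<in> D" "Im z \<noteq> 0" and I: "I \<in> imag_units"
  shows "spherical_deriv (primal_part D f) (slice_point I z) = (1 / Im z) *\<^sub>R primal (snd (F z))"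
proof -
  define G where "G z = (primal (fst (stem_of D f z)), primal (snd (stem_of D f z)))" for z
  have G: "stem_function D G"
    using stem_of_eq(1)[OF D F f] by (simp add: stem_function_def G_def uminus_dquat_def)
  have cz: "cnj z \<in> D" using D z by blast
  have qc: "qconj (slice_point I z) = slice_point I (cnj z)" and im: "quat_Im (slice_point I z) = Im z *\<^sub>R I"
    using I by (auto simp: imag_units_def tr_def nm_def quat_eq_iff zero_quat_def one_quat_def
        plus_quat_def qconj_quat_def slice_point_def of_real_def scaleR_quat_def quat_Im_def
        minus_quat_def)
  have I0: "I \<noteq> 0" using imag_units_square[OF I] by auto
  have p: "primal_part D f (slice_point I w) = stem_eval G I w" if "w \<in> D" for w
    unfolding primal_part_def G_def[symmetric] by (rule slice_fun_slice_point[OF D G that I])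
  have "stem_eval G I z - stem_eval G I (cnj z) = 2 *\<^sub>R (I * snd (G z))"
    using G z by (simp add: stem_function_def stem_eval_def scaleR_2)
  then have "spherical_deriv (primal_part D f) (slice_point I z)
      = (1 / 2) *\<^sub>R (inverse (Im z *\<^sub>R I) * (2 *\<^sub>R (I * snd (G z))))"
    by (simp add: spherical_deriv_def qc im p z cz)
  also have "inverse (Im z *\<^sub>R I) = (1 / Im z) *\<^sub>R inverse I"
    using z I0 by (intro inverse_unique) simp
  also have "(1 / 2) *\<^sub>R ((1 / Im z) *\<^sub>R inverse I * (2 *\<^sub>R (I * snd (G z))))
      = (1 / Im z) *\<^sub>R (inverse I * I * snd (G z))"
    by (simp add: mult.assoc)
  also have "\<dots> = (1 / Im z) *\<^sub>R primal (snd (F z))"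
    using I0 stem_of_eq(2)[OF D F f z(1)] by (simp add: G_def)
  finally show ?thesis .
qed

lemma spherical_deriv_nonzero_iff:
  assumes D: "cnj ` D = D" and F: "stem_function D F" and f: "\<forall>x\<in>Omega D. f x = slice_fun F x"
  shows "(\<exists>w\<in>Omega_quat D - \<real>. spherical_deriv (primal_part D f) w \<noteq> 0) \<longleftrightarrow>
    (\<exists>z\<in>D. Im z \<noteq> 0 \<and> primal (snd (F z)) \<noteq> 0)"
proof
  assume "\<exists>w\<in>Omega_quat D - \<real>. spherical_deriv (primal_part D f) w \<noteq> 0"
  then obtain w where w: "DQuat w 0 \<in> Omega D" "w \<notin> \<real>" "spherical_deriv (primal_part D f) w \<noteq> 0"
    by (auto simp: Omega_quat_def)
  obtain z J where z: "z \<in> D" "J \<in> imag_units" "DQuat w 0 = slice_point J z"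
    using Omega_cases[OF w(1)] .
  \<comment> \<open>Taking primal parts replaces J by the quaternionic unit J_1.\<close>
  have wz: "w = slice_point (primal J) z"
    using z(3) by (simp add: slice_point_def of_real_dquat plus_dquat_def scaleR_dquat_def)
  have "Im z \<noteq> 0" using w(2) wz by (auto simp: slice_point_def)
  then show "\<exists>z\<in>D. Im z \<noteq> 0 \<and> primal (snd (F z)) \<noteq> 0"
    using spherical_deriv_primal_part[OF D F f z(1), of "primal J"] w(3) wz z imag_units_dquat_iff
    by auto
next
  assume "\<exists>z\<in>D. Im z \<noteq> 0 \<and> primal (snd (F z)) \<noteq> 0"
  then obtain z where z: "z \<in> D" "Im z \<noteq> 0" "primal (snd (F z)) \<noteq> 0" by blast
  define I where "I = Quat 0 1 0 0"
  have I: "I \<in> imag_units" by (simp add: I_def quat_i_imag_unit)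
  have "DQuat (slice_point I z) 0 = slice_point (DQuat I 0) z"
    by (simp add: slice_point_def of_real_dquat plus_dquat_def scaleR_dquat_def)
  then have "slice_point I z \<in> Omega_quat D"
    using z(1) I slice_point_in_Omega_iff[OF D] by (simp add: Omega_quat_def DQuat_imag_unit)
  moreover have "slice_point I z \<notin> \<real>"
    using z(2) by (auto simp: Reals_def slice_point_def I_def of_real_def quat_eq_iff plus_quat_def
        scaleR_quat_def one_quat_def)
  ultimately show "\<exists>w\<in>Omega_quat D - \<real>. spherical_deriv (primal_part D f) w \<noteq> 0"
    using spherical_deriv_primal_part[OF D F f z(1,2) I] z by (intro bexI[of _ "slice_point I z"]) auto
qed


section \<open>The zero set of a slice regular function\<close>

text \<open>The free set S covers whole slices as well as half slices.\<close>

lemma zero_set_slice: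
  fixes J :: dquat
  assumes D: "cnj ` D = D" and F: "stem_function D F" and f: "\<forall>x\<in>Omega D. f x = slice_fun F x"
    and J: "J \<in> imag_units"
  shows "zero_set D f \<inter> slice_point J ` S = slice_point J ` {z \<in> D \<inter> S. stem_eval F J z = 0}"
  using slice_fun_slice_point[OF D F _ J] slice_point_in_Omega_iff[OF D J] f
  by (auto simp: zero_set_def image_iff)

text \<open>One slice decides: D is symmetric, so g_J = 0 on D gives g_{-J} = 0 on D, and then both
  components of F vanish.\<close>

lemma vanishes_iff:
  fixes F :: "complex \<Rightarrow> dquat \<times> dquat"
  assumes D: "cnj ` D = D" and F: "stem_function D F" and f: "\<forall>x\<in>Omega D. f x = slice_fun F x"
    and J: "J \<in> imag_units"
  shows "(\<forall>x\<in>Omega D. f x = 0) \<longleftrightarrow> (\<forall>z\<in>D. stem_eval F J z = 0)"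
proof
  assume "\<forall>x\<in>Omega D. f x = 0"
  then show "\<forall>z\<in>D. stem_eval F J z = 0"
    using slice_fun_slice_point[OF D F _ J] slice_point_in_Omega_iff[OF D J] f by metis
next
  assume z: "\<forall>z\<in>D. stem_eval F J z = 0"
  have "fst (F z) = 0 \<and> snd (F z) = 0" if "z \<in> D" for z
    using stem_eval_zero[OF J] z stem_eval_cnj[OF F that] that D by (metis imageI)
  then show "\<forall>x\<in>Omega D. f x = 0"
    using f slice_fun_slice_point[OF D F] by (metis Omega_cases add_0 mult_zero_right stem_eval_def)
qed

text \<open>Quaternions have no zero divisors. If exactly one primal part is zero, the epsilon-part
  of the product forces the dual part of that factor to be zero too.\<close>

lemma dquat_mult_eq_zero_iff:
  fixes a b :: dquat
  shows "a * b = 0 \<longleftrightarrow> a = 0 \<or> b = 0 \<or> primal a = 0 \<and> primal b = 0"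
  by (auto simp: dquat_eq_iff zero_dquat_def times_dquat_def)

text \<open>On A, g_K governs the positive half of the slice of K and g_{-K} the negative half. As f
  is not identically zero, they cannot both vanish on A, so vanishing of the first already yields
  discreteness on the other half.\<close>

lemma zero_set_product_domain:
  fixes F :: "complex \<Rightarrow> dquat \<times> dquat"
  assumes D: "cnj ` D = D" and F: "stem_function D F" and f: "\<forall>x\<in>Omega D. f x = slice_fun F x"
    and reg: "regular_stem D F" and A: "open A" "connected A" "A \<subseteq> {z. 0 < Im z}"
    and DA: "D = A \<union> cnj ` A" and nz: "\<not> (\<forall>x\<in>Omega D. f x = 0)"
  shows half_zero_units_eq: "half_zero_units D f = {J \<in> imag_units. \<forall>z\<in>A. stem_eval F J z = 0}"
    and closed_discrete_in_other: "\<And>K. K \<in> imag_units \<Longrightarrow> K \<notin> half_zero_units D f \<Longrightarrow>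
      - K \<notin> half_zero_units D f \<Longrightarrow> closed_discrete_in (Omega D \<inter> slice K) (zero_set D f \<inter> slice K)"
proof -
  have "open (cnj ` A)"
    unfolding image_cnj_conv_vimage_cnj by (intro open_vimage A continuous_intros)
  then have B: "open (cnj ` A)" "connected (cnj ` A)" "cnj ` A \<subseteq> {z. Im z < 0}"
    using A by (auto intro!: connected_continuous_image continuous_intros)
  have ev_cnj: "stem_eval F J (cnj z) = stem_eval F (- J) z" if "z \<in> A" for J z
    using stem_eval_cnj[OF F] that DA by blast
  have noA: "\<not> z islimpt {w \<in> D. stem_eval F J w = 0}"
    if J: "J \<in> imag_units" and ne: "\<not> (\<forall>z\<in>A. stem_eval F J z = 0)"
      and z: "z \<in> A" for J z
  proof -
    obtain c where "c \<in> A" "stem_eval F J c \<noteq> 0" using ne by blast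
    then show ?thesis
      using stem_eval_zeros_no_limpt[OF reg J A(1,2)] z DA by blast
  qed
  \<comment> \<open>The mirror image of \<open>noA\<close>: g_J on the lower component is g_{-J} on
    A.\<close>
  have noB: "\<not> z islimpt {w \<in> D. stem_eval F J w = 0}"
    if J: "J \<in> imag_units" and ne: "\<not> (\<forall>z\<in>A. stem_eval F (- J) z = 0)"
      and z: "z \<in> cnj ` A" for J z
  proof -
    obtain c where c: "c \<in> A" "stem_eval F (- J) c \<noteq> 0" using ne by blast
    then have "cnj c \<in> cnj ` A" "stem_eval F J (cnj c) \<noteq> 0" by (simp_all add: ev_cnj)
    then show ?thesis
      using stem_eval_zeros_no_limpt[OF reg J B(1,2)] z DA by blast
  qed
  show eq: "half_zero_units D f = {J \<in> imag_units. \<forall>z\<in>A. stem_eval F J z = 0}"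
  proof (intro set_eqI iffI)
    fix J assume "J \<in> half_zero_units D f"
    then have J: "J \<in> imag_units" and 0: "\<And>x. x \<in> Omega D \<inter> slice_pos J \<Longrightarrow> f x = 0"
      by (auto simp: half_zero_units_def)
    have "stem_eval F J z = 0" if "z \<in> A" for z
    proof -
      have "z \<in> D" "slice_point J z \<in> slice_pos J"
        using that DA A(3) by (auto simp: slice_pos_eq)
      then show ?thesis
        using 0 slice_fun_slice_point[OF D F _ J] slice_point_in_Omega_iff[OF D J] f by (metis IntI)
    qed
    with J show "J \<in> {J \<in> imag_units. \<forall>z\<in>A. stem_eval F J z = 0}" by blast
  next
    fix J assume "J \<in> {J \<in> imag_units. \<forall>z\<in>A. stem_eval F J z = 0}"
    then have J: "J \<in> imag_units" and JA: "\<And>z. z \<in> A \<Longrightarrow> stem_eval F J z = 0" by auto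
    have nB: "\<not> (\<forall>z\<in>A. stem_eval F (- J) z = 0)"
      using JA nz vanishes_iff[OF D F f J] DA ev_cnj by auto
    have "f x = 0" if x: "x \<in> Omega D \<inter> slice_pos J" for x
    proof -
      obtain z where z: "0 < Im z" "x = slice_point J z" using x by (auto simp: slice_pos_eq)
      then have "z \<in> D" using x slice_point_in_Omega_iff[OF D J] by auto
      then have "z \<in> A" using z B(3) DA by force
      then show ?thesis
        using JA x z f slice_fun_slice_point[OF D F \<open>z \<in> D\<close> J] by auto
    qed
    moreover have "closed_discrete_in (Omega D \<inter> slice J) (zero_set D f \<inter> slice_neg J)"
      unfolding slice_neg_eq zero_set_slice[OF D F f J]
    proof (rule closed_discrete_in_slice[OF D J])
      fix z assume "z \<in> D"
      then consider "z \<in> A" | "z \<in> cnj ` A" using DA by blast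
      then show "\<not> z islimpt {z \<in> D \<inter> {z. Im z < 0}. stem_eval F J z = 0}"
      proof cases
        \<comment> \<open>Closedness refers to the whole slice, so points of A must be excluded as
          limit points as well; A is open and misses the lower half-plane.\<close>
        case 1
        show ?thesis
        proof
          assume "z islimpt {z \<in> D \<inter> {z. Im z < 0}. stem_eval F J z = 0}"
          from islimptE[OF this 1 A(1)] obtain y where "y \<in> A" "Im y < 0" by blast
          with A(3) show False by force
        qed
      next
        case 2
        from noB[OF J nB 2] show ?thesis
          by (rule contrapos_nn) (erule islimpt_subset, blast)
      qed
    qed blast
    ultimately show "J \<in> half_zero_units D f"
      using J by (auto simp: half_zero_units_def)
  qed
  fix K assume K: "K \<in> imag_units" "K \<notin> half_zero_units D f" "- K \<notin> half_zero_units D f"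
  have n: "\<not> (\<forall>z\<in>A. stem_eval F K z = 0)" "\<not> (\<forall>z\<in>A. stem_eval F (- K) z = 0)"
    using K uminus_imag_units[OF K(1)] unfolding eq by auto
  \<comment> \<open>\<open>UNIV\<close> matches \<open>zero_set_slice\<close> for the full slice,
    which is a range.\<close>
  have "\<not> z islimpt {w \<in> D \<inter> UNIV. stem_eval F K w = 0}" if "z \<in> D" for z
  proof -
    have "z \<in> A \<or> z \<in> cnj ` A" using that DA by blast
    with noA[OF K(1) n(1)] noB[OF K(1) n(2)] show ?thesis unfolding Int_UNIV_right by blast
  qed
  then show "closed_discrete_in (Omega D \<inter> slice K) (zero_set D f \<inter> slice K)"
    unfolding slice_eq[of K] zero_set_slice[OF D F f K(1)]
    by (intro closed_discrete_in_slice[OF D K(1), unfolded slice_eq]) blast+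
qed

text \<open>Once g_J vanishes on A, g_K does so iff (J - K) F_2 = 0 there, and the zero-product
  criterion solves this for K.\<close>

lemma half_zero_units_cases:
  fixes F :: "complex \<Rightarrow> dquat \<times> dquat"
  assumes D: "cnj ` D = D" and F: "stem_function D F" and f: "\<forall>x\<in>Omega D. f x = slice_fun F x"
    and reg: "regular_stem D F" and A: "open A" "connected A" "A \<subseteq> {z. 0 < Im z}"
    and DA: "D = A \<union> cnj ` A" and nz: "\<not> (\<forall>x\<in>Omega D. f x = 0)" and J: "J \<in> half_zero_units D f"
  shows "\<exists>z\<in>D. primal (snd (F z)) \<noteq> 0 \<Longrightarrow> half_zero_units D f = {J}"
    and "\<forall>z\<in>D. primal (snd (F z)) = 0 \<Longrightarrow> half_zero_units D f = T_set (primal J)"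
proof -
  note hzu = half_zero_units_eq[OF D F f reg A DA nz]
  have Ju: "J \<in> imag_units" and JA: "\<And>z. z \<in> A \<Longrightarrow> stem_eval F J z = 0"
    using J unfolding hzu by auto
  have diff: "stem_eval F J z - stem_eval F K z = (J - K) * snd (F z)" for K z
    by (simp add: stem_eval_def algebra_simps)
  have mem: "K \<in> half_zero_units D f \<longleftrightarrow> K \<in> imag_units \<and> (\<forall>z\<in>A. (J - K) * snd (F z) = 0)" for K
    unfolding hzu using JA by (auto simp flip: diff)
  have cz: "snd (F (cnj z)) = - snd (F z)" if "z \<in> A" for z
    using that F DA by (auto simp: stem_function_def)
  show "half_zero_units D f = {J}" if nz2: "\<exists>z\<in>D. primal (snd (F z)) \<noteq> 0"
  proof -
    have neg: "primal (- x) = - primal x" for x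
      by (simp add: uminus_dquat_def)
    \<comment> \<open>A point found in the lower component is reflected; F_2 only changes
      sign.\<close>
    obtain z where z: "z \<in> A" "primal (snd (F z)) \<noteq> 0"
      using nz2 DA cz neg by (metis Un_iff imageE neg_0_equal_iff_equal)
    have z0: "snd (F z) \<noteq> 0"
      using z(2) by (metis dquat.sel(1) zero_dquat_def)
    have "K = J" if "K \<in> half_zero_units D f" for K
      using that z z0 unfolding mem dquat_mult_eq_zero_iff by auto
    then show ?thesis using J by blast
  qed
  show "half_zero_units D f = T_set (primal J)" if p: "\<forall>z\<in>D. primal (snd (F z)) = 0"
  proof -
    \<comment> \<open>If F_2 were zero on A, F_1 = g_J would be zero there too, and by symmetry f
      would vanish identically.\<close>
    have "\<exists>z\<in>A. snd (F z) \<noteq> 0"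
    proof (rule ccontr)
      assume "\<not> (\<exists>z\<in>A. snd (F z) \<noteq> 0)"
      then have "stem_eval F J (cnj z) = 0" if "z \<in> A" for z
        using JA[OF that] that DA F by (simp add: stem_eval_def stem_function_def)
      then show False using nz vanishes_iff[OF D F f Ju] JA DA by auto
    qed
    then obtain z where z: "z \<in> A" "snd (F z) \<noteq> 0" by blast
    \<comment> \<open>At this z the second factor is nonzero with zero primal part, so exactly the
      condition that J - K has zero primal part remains.\<close>
    have "K \<in> half_zero_units D f \<longleftrightarrow> K \<in> imag_units \<and> primal K = primal J" for K
      unfolding mem dquat_mult_eq_zero_iff using p z DA by (auto simp: minus_dquat_def zero_dquat_def)
    then show ?thesis unfolding T_set_primal[OF Ju] by blast
  qed
qed

(* In the last clause -K is excluded along with K: the slices of J and -J coincide, so if f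
   vanishes on the positive half of the slice of J, its zero set on the slice of -J is not
   discrete, although -J itself is not in half_zero_units D f. *)
theorem theorem7p2:
  fixes D :: "complex set" and f :: "dquat \<Rightarrow> dquat"
  assumes "open D" and "cnj ` D = D" and "f \<in> slice_regular D"
  shows "(slice_domain D \<longrightarrow>
      (\<forall>J\<in>imag_units. closed_discrete_in (Omega D \<inter> slice J) (zero_set D f \<inter> slice J)) \<or>
      (\<forall>x\<in>Omega D. f x = 0)) \<and>
    (product_domain D \<longrightarrow>
      (\<forall>J\<in>imag_units. closed_discrete_in (Omega D \<inter> slice J) (zero_set D f \<inter> slice J)) \<or>
      (\<forall>x\<in>Omega D. f x = 0) \<or>
      (\<exists>J\<in>half_zero_units D f.
        ((\<exists>w\<in>Omega_quat D - \<real>. spherical_deriv (primal_part D f) w \<noteq> 0) \<longrightarrow>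
           half_zero_units D f = {J}) \<and>
        ((\<forall>w\<in>Omega_quat D - \<real>. spherical_deriv (primal_part D f) w = 0) \<longrightarrow>
           half_zero_units D f = T_set (primal J)) \<and>
        (\<forall>K\<in>imag_units. K \<notin> half_zero_units D f \<and> - K \<notin> half_zero_units D f \<longrightarrow>
           closed_discrete_in (Omega D \<inter> slice K) (zero_set D f \<inter> slice K))))"
proof -
  obtain F where F: "stem_function D F" and reg: "regular_stem D F"
    and f: "\<forall>x\<in>Omega D. f x = slice_fun F x"
    using assms(3) by (auto simp: slice_regular_def)
  note D = assms(2)
  show ?thesis
  proof (cases "\<forall>x\<in>Omega D. f x = 0")
    case nz: False
    have "closed_discrete_in (Omega D \<inter> slice J) (zero_set D f \<inter> slice J)"
      if "slice_domain D" and J: "J \<in> imag_units" for J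
    proof -
      have "open D" "connected D" using that by (auto simp: slice_domain_def)
      \<comment> \<open>A nonzero f is nonzero somewhere on every slice, so the identity theorem
        applies with D itself as the connected set.\<close>
      moreover obtain c where "c \<in> D" "stem_eval F J c \<noteq> 0"
        using nz vanishes_iff[OF D F f J] by blast
      ultimately have "\<not> z islimpt {w \<in> D \<inter> UNIV. stem_eval F J w = 0}" if "z \<in> D" for z
        using stem_eval_zeros_no_limpt[OF reg J _ _ order.refl _ _ that] by simp
      then show ?thesis
        unfolding slice_eq[of J] zero_set_slice[OF D F f J]
        by (intro closed_discrete_in_slice[OF D J, unfolded slice_eq]) auto
    qed
    moreover have "\<exists>J\<in>half_zero_units D f.
        ((\<exists>w\<in>Omega_quat D - \<real>. spherical_deriv (primal_part D f) w \<noteq> 0) \<longrightarrow>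
           half_zero_units D f = {J}) \<and>
        ((\<forall>w\<in>Omega_quat D - \<real>. spherical_deriv (primal_part D f) w = 0) \<longrightarrow>
           half_zero_units D f = T_set (primal J)) \<and>
        (\<forall>K\<in>imag_units. K \<notin> half_zero_units D f \<and> - K \<notin> half_zero_units D f \<longrightarrow>
           closed_discrete_in (Omega D \<inter> slice K) (zero_set D f \<inter> slice K))"
      if pd: "product_domain D"
        and n1: "\<not> (\<forall>J\<in>imag_units. closed_discrete_in (Omega D \<inter> slice J) (zero_set D f \<inter> slice J))"
    proof -
      obtain A where A: "open A" "connected A" "A \<subseteq> {z. 0 < Im z}" and DA: "D = A \<union> cnj ` A"
        using product_domain_upper_half[OF pd] by metis
      note other = closed_discrete_in_other[OF D F f reg A DA nz]
      \<comment> \<open>If there were no such unit, \<open>other\<close> would apply to every K and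
        give case (1).\<close>
      obtain J where J: "J \<in> half_zero_units D f" using n1 other by blast
      have im: "Im z \<noteq> 0" if "z \<in> D" for z using that DA A(3) by auto
      \<comment> \<open>D misses the real axis, so the restriction to nonreal z disappears.\<close>
      have sd: "(\<exists>w\<in>Omega_quat D - \<real>. spherical_deriv (primal_part D f) w \<noteq> 0) \<longleftrightarrow>
          (\<exists>z\<in>D. primal (snd (F z)) \<noteq> 0)"
        unfolding spherical_deriv_nonzero_iff[OF D F f] using im by blast
      then show ?thesis
        using half_zero_units_cases[OF D F f reg A DA nz J] J other by (intro bexI[of _ J]) blast+
    qed
    ultimately show ?thesis by blast
  qed blast
qed

end
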